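(* Let $\mathcal T$ be a tower of length $\omega_1$. Then $\mathcal T$ is Hausdorff if and only if $\langle\mathcal T\rangle\equiv[\omega_1]^{<\omega}$.
   Context: A tower of length $\omega_1$ is a family $\mathcal T=(T_\alpha)_{\alpha<\omega_1}$ of subsets of $\omega$ such that, for all $\alpha,\beta<\omega_1$, $T_\alpha\setminus T_\beta$ is finite if and only if $\alpha\le\beta$ (no maximality is assumed). A tower satisfies condition (H) if for each $\alpha<\omega_1$ and $n<\omega$ the set $\{\xi<\alpha : T_\xi\setminus T_\alpha\subseteq n\}$ is finite (here $n=\{0,\dots,n-1\}$). A tower is Hausdorff if it has a cofinal subtower satisfying (H), i.e. there is an uncountable $X\subseteq\omega_1$ such that $(T_\alpha)_{\alpha\in X}$, re-enumerated increasingly in order type $\omega_1$, satisfies (H). $\langle\mathcal T\rangle$ denotes the ideal on $\omega$ generated by $\mathcal T$ and all finite subsets of $\omega$, ordered by $\subseteq$; $[\omega_1]^{<\omega}$ is the set of finite subsets of $\omega_1$ ordered by $\subseteq$. For directed sets $\mathcal D,\mathcal E$, a function $g\colon\mathcal D\to\mathcal E$ is Tukey if the image of every unbounded subset of $\mathcal D$ is unbounded in $\mathcal E$; $\mathcal D\le_T\mathcal E$ means that such a $g$ exists; $\mathcal D\equiv\mathcal E$ (Tukey equivalent) means $\mathcal D\le_T\mathcal E$ and $\mathcal E\le_T\mathcal D$. *)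

theory Defs
  imports HOL.Hull "HOL-Library.FuncSet" "HOL-Library.Countable_Set_Type"
begin

text \<open>
  The ordinal \<open>\<omega>\<^sub>1\<close> is realised as the field of the well-order \<open>cardSuc natLeq\<close>
  (the initial well-order of the successor cardinal of \<open>\<aleph>\<^sub>0\<close>).
\<close>

typedef omega1 = "Field (cardSuc natLeq)"
  using cardSuc_finite[OF natLeq_Card_order]
  by (metis all_not_in_conv finite.emptyI Field_natLeq infinite_UNIV_nat)

instantiation omega1 :: linorder
begin

definition less_eq_omega1 :: "omega1 \<Rightarrow> omega1 \<Rightarrow> bool"
  where "less_eq_omega1 x y \<longleftrightarrow> (Rep_omega1 x, Rep_omega1 y) \<in> cardSuc natLeq"

definition less_omega1 :: "omega1 \<Rightarrow> omega1 \<Rightarrow> bool"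
  where "less_omega1 x y \<longleftrightarrow> x \<le> y \<and> \<not> y \<le> x"

instance
proof -
  have wo: "Well_order (cardSuc natLeq)"
    using cardSuc_Card_order[OF natLeq_Card_order] card_order_on_well_order_on by blast
  then have lin: "Linear_order (cardSuc natLeq)"
    by (simp add: well_order_on_def)
  then have r: "Refl (cardSuc natLeq)" and t: "trans (cardSuc natLeq)"
    and a: "antisym (cardSuc natLeq)" and tot: "Total (cardSuc natLeq)"
    by (auto simp: order_on_defs)
  show "OFCLASS(omega1, linorder_class)"
  proof
    fix x y z :: omega1
    show "x < y \<longleftrightarrow> x \<le> y \<and> \<not> y \<le> x" by (rule less_omega1_def)
    show refl: "x \<le> x"
      using r Rep_omega1[of x] by (auto simp: less_eq_omega1_def refl_on_def)
    show "x \<le> z" if "x \<le> y" "y \<le> z"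
      using that transD[OF t] unfolding less_eq_omega1_def by blast
    show "x = y" if "x \<le> y" "y \<le> x"
      using that antisymD[OF a] unfolding less_eq_omega1_def by (metis Rep_omega1_inject)
    show "x \<le> y \<or> y \<le> x"
      using refl tot Rep_omega1[of x] Rep_omega1[of y]
      unfolding less_eq_omega1_def total_on_def by (metis Rep_omega1_inject)
  qed
qed

end

lemma Rep_omega1_less_iff:
  "x < y \<longleftrightarrow> (Rep_omega1 x, Rep_omega1 y) \<in> cardSuc natLeq - Id"
  by (simp add: less_le less_eq_omega1_def Rep_omega1_inject)

instance omega1 :: wellorder
proof
  fix P :: "omega1 \<Rightarrow> bool" and a :: omega1
  assume step: "\<And>x. (\<And>y. y < x \<Longrightarrow> P y) \<Longrightarrow> P x"
  have "wf (cardSuc natLeq - Id)"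
    using cardSuc_Card_order[OF natLeq_Card_order] card_order_on_well_order_on
      well_order_on_def by blast
  then have "wf (inv_image (cardSuc natLeq - Id) Rep_omega1)"
    by (rule wf_inv_image)
  then show "P a"
    by (induction a rule: wf_induct_rule)
       (rule step, simp add: Rep_omega1_less_iff in_inv_image)
qed

lemma uncountable_omega1: "uncountable (UNIV :: omega1 set)"
proof
  include cardinal_syntax
  assume "countable (UNIV :: omega1 set)"
  then have "countable (range Rep_omega1)" by simp
  then have "countable (Field (cardSuc natLeq))"
    by (metis type_definition.Rep_range type_definition_omega1)
  then have "|Field (cardSuc natLeq)| \<le>o natLeq"
    using countable_card_le_natLeq by blast
  then have "cardSuc natLeq \<le>o natLeq"
    by (meson card_of_Field_ordIso cardSuc_Card_order natLeq_Card_order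
        ordIso_ordLeq_trans ordIso_symmetric)
  then show False
    using cardSuc_greater[OF natLeq_Card_order] not_ordLess_ordLeq by blast
qed

lemma countable_initial_segment_omega1: "countable {..<a :: omega1}"
proof -
  include cardinal_syntax
  let ?r = "cardSuc natLeq"
  have "|underS ?r (Rep_omega1 a)| <o ?r"
    using card_of_underS[OF cardSuc_Card_order[OF natLeq_Card_order]] Rep_omega1 by blast
  then have "|underS ?r (Rep_omega1 a)| \<le>o natLeq"
    by (simp add: cardSuc_ordLeq_ordLess[OF natLeq_Card_order card_of_Card_order])
  then have "countable (underS ?r (Rep_omega1 a))"
    using countable_card_le_natLeq by blast
  moreover have "Rep_omega1 ` {..<a} \<subseteq> underS ?r (Rep_omega1 a)"
    by (auto simp: underS_def Rep_omega1_less_iff)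
  ultimately have "countable (Rep_omega1 ` {..<a})"
    by (rule countable_subset[rotated])
  then show ?thesis
    by (rule countable_image_inj_on) (simp add: inj_on_def Rep_omega1_inject)
qed

definition tower :: "(omega1 \<Rightarrow> nat set) \<Rightarrow> bool" where
  "tower T \<longleftrightarrow> (\<forall>\<alpha> \<beta>. finite (T \<alpha> - T \<beta>) \<longleftrightarrow> \<alpha> \<le> \<beta>)"

definition condition_H :: "(omega1 \<Rightarrow> nat set) \<Rightarrow> bool" where
  "condition_H T \<longleftrightarrow> (\<forall>\<alpha> n. finite {\<xi>. \<xi> < \<alpha> \<and> T \<xi> - T \<alpha> \<subseteq> {..<n}})"

text \<open>
  \<open>e\<close> is the increasing enumeration of the uncountable index set \<open>X\<close> in order type \<open>\<omega>\<^sub>1\<close>.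
\<close>

definition Hausdorff_tower :: "(omega1 \<Rightarrow> nat set) \<Rightarrow> bool" where
  "Hausdorff_tower T \<longleftrightarrow>
    (\<exists>X. uncountable X \<and>
      (\<exists>e :: omega1 \<Rightarrow> omega1. strict_mono e \<and> range e = X \<and> condition_H (T \<circ> e)))"

definition set_ideal :: "'a set set \<Rightarrow> bool" where
  "set_ideal I \<longleftrightarrow>
    {} \<in> I \<and> (\<forall>A\<in>I. \<forall>B. B \<subseteq> A \<longrightarrow> B \<in> I) \<and> (\<forall>A\<in>I. \<forall>B\<in>I. A \<union> B \<in> I)"

text \<open>
  Properness of ideals is not required; for a tower of length \<open>\<omega>\<^sub>1\<close> the generated
  ideal is proper anyway, since no \<open>T \<alpha>\<close> is cofinite.
\<close>

definition tower_ideal :: "(omega1 \<Rightarrow> nat set) \<Rightarrow> nat set set" where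
  "tower_ideal T = set_ideal hull (range T \<union> Collect finite)"

lemma set_ideal_tower_ideal: "set_ideal (tower_ideal T)"
  unfolding tower_ideal_def
  by (rule hull_in) (auto simp: set_ideal_def)

text \<open>
  A directed set is given by a carrier inside a preordered type; boundedness is relative
  to the carrier, unlike \<^const>\<open>bdd_above\<close>.
\<close>

definition directed_set :: "'a::preorder set \<Rightarrow> bool" where
  "directed_set D \<longleftrightarrow> D \<noteq> {} \<and> (\<forall>x\<in>D. \<forall>y\<in>D. \<exists>z\<in>D. x \<le> z \<and> y \<le> z)"

definition bounded_in :: "'a::preorder set \<Rightarrow> 'a set \<Rightarrow> bool" where
  "bounded_in D S \<longleftrightarrow> (\<exists>b\<in>D. \<forall>x\<in>S. x \<le> b)"

definition tukey_map :: "'a::preorder set \<Rightarrow> 'b::preorder set \<Rightarrow> ('a \<Rightarrow> 'b) \<Rightarrow> bool" where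
  "tukey_map D E g \<longleftrightarrow>
    g \<in> D \<rightarrow> E \<and> (\<forall>S\<subseteq>D. \<not> bounded_in D S \<longrightarrow> \<not> bounded_in E (g ` S))"

definition tukey_le :: "'a::preorder set \<Rightarrow> 'b::preorder set \<Rightarrow> bool" where
  "tukey_le D E \<longleftrightarrow> (\<exists>g. tukey_map D E g)"

definition tukey_equivalent :: "'a::preorder set \<Rightarrow> 'b::preorder set \<Rightarrow> bool" where
  "tukey_equivalent D E \<longleftrightarrow> tukey_le D E \<and> tukey_le E D"

lemma directed_set_tower_ideal: "directed_set (tower_ideal T)"
  using set_ideal_tower_ideal[of T]
  unfolding set_ideal_def directed_set_def by (metis Un_upper1 Un_upper2 empty_iff)

lemma directed_set_Fpow: "directed_set (Fpow A)"
  unfolding directed_set_def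
proof (intro conjI ballI)
  show "Fpow A \<noteq> {}" by (auto simp: Fpow_def)
  show "\<exists>z\<in>Fpow A. x \<le> z \<and> y \<le> z" if "x \<in> Fpow A" "y \<in> Fpow A" for x y
    using that by (intro bexI[of _ "x \<union> y"]) (auto simp: Fpow_def)
qed

end

theory Submission
  imports Defs
begin

text \<open>
  By almost-monotonicity, the sets \<open>T \<alpha> \<union> {..<n}\<close> are cofinal in the ideal generated by the
  tower. Only \<open>\<aleph>\<^sub>1\<close> many such sets exist, and this alone makes the ideal Tukey below the
  directed set \<open>Fpow \<omega>\<^sub>1\<close> of finite subsets of \<open>\<omega>\<^sub>1\<close> (lemma \<open>tower_ideal_tukey_le_Fpow\<close>). So the theorem says that being Hausdorff
  is the same as \<open>Fpow \<omega>\<^sub>1\<close> being Tukey below the ideal, which amounts to having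
  \<open>\<aleph>\<^sub>1\<close> members of the ideal such that any infinitely many of them are unbounded.

  Condition (H) says precisely that the members of the (sub)tower have this property: a bound
  may be taken of the form \<open>T \<alpha> \<union> {..<n}\<close>, and only finitely many \<open>T \<xi>\<close> lie below such a set.
  Hence \<open>F \<mapsto> \<Union>\<xi>\<in>F. T (e \<xi>)\<close> is a Tukey map, where \<open>e\<close> enumerates the subtower.

  Conversely, let \<open>g\<close> be a Tukey map from \<open>Fpow \<omega>\<^sub>1\<close>. Cover each \<open>g {\<xi>}\<close> by a set
  \<open>T (h \<xi>) \<union> {..<m \<xi>}\<close>. On an uncountable set \<open>m\<close> has a constant value \<open>k\<close>, and there \<open>h\<close> is
  finite-to-one, so its image \<open>X\<close> is uncountable. A bound for infinitely many of the sets
  \<open>T \<beta>\<close>, \<open>\<beta> \<in> X\<close>, would after adding \<open>{..<k}\<close> bound infinitely many \<open>g {\<xi>}\<close>, which is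
  impossible (lemma \<open>uncountable_subfamily_finite_below\<close>). An increasing
  \<open>\<omega>\<^sub>1\<close>-sequence in \<open>X\<close> is then a subtower with (H).
\<close>

section \<open>Increasing sequences of length \<open>\<omega>\<^sub>1\<close>\<close>

lemma strict_mono_omega1_increasing:
  fixes e :: "omega1 \<Rightarrow> omega1"
  assumes "strict_mono e"
  shows "\<alpha> \<le> e \<alpha>"
proof (induction \<alpha> rule: less_induct)
  case (less \<alpha>)
  show ?case
  proof (rule ccontr)
    assume "\<not> \<alpha> \<le> e \<alpha>"
    then have "e \<alpha> < \<alpha>" by simp
    then have "e \<alpha> \<le> e (e \<alpha>)" "e (e \<alpha>) < e \<alpha>"
      using less.IH assms by (auto simp: strict_mono_def)
    then show False by simp
  qed
qed

text \<open>
  An uncountable set contains a point above any given countable set, because countably many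
  initial segments have a countable union; so the sequence can be built by recursion.
\<close>

lemma uncountable_omega1_strict_mono:
  fixes X :: "omega1 set"
  assumes X: "uncountable X"
  obtains e :: "omega1 \<Rightarrow> omega1" where "strict_mono e" and "range e \<subseteq> X"
proof -
  have step: "\<exists>r. r \<in> X \<and> (\<forall>z<x. f z < r)" for x and f :: "omega1 \<Rightarrow> omega1"
  proof -
    have "{..f z} = insert (f z) {..<f z}" for z by auto
    then have "countable (\<Union>z\<in>{..<x}. {..f z})"
      by (auto simp: countable_initial_segment_omega1)
    then have "\<not> X \<subseteq> (\<Union>z\<in>{..<x}. {..f z})"
      using X countable_subset by blast
    then show ?thesis by (auto simp: not_le)
  qed
  have "\<exists>e. \<forall>x :: omega1. e x \<in> X \<and> (\<forall>z<x. e z < e x)"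
    by (rule dependent_wf_choice[OF wf,
          where P = "\<lambda>f x r. r \<in> X \<and> (\<forall>z<x. f z < r)"])
      (auto simp: step)
  then obtain e :: "omega1 \<Rightarrow> omega1" where e: "e x \<in> X" "z < x \<Longrightarrow> e z < e x" for x z
    by blast
  show thesis
    by (rule that[of e]) (auto simp: strict_mono_def e)
qed

section \<open>The ideal generated by a tower\<close>

lemma tower_in_tower_ideal: "T \<alpha> \<in> tower_ideal T"
  unfolding tower_ideal_def by (rule hull_inc) simp

lemma finite_in_tower_ideal: "finite A \<Longrightarrow> A \<in> tower_ideal T"
  unfolding tower_ideal_def by (rule hull_inc) simp

lemma tower_ideal_Un:
  "A \<in> tower_ideal T \<Longrightarrow> B \<in> tower_ideal T \<Longrightarrow> A \<union> B \<in> tower_ideal T"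
  using set_ideal_tower_ideal[of T] unfolding set_ideal_def by blast

lemma tower_ideal_UN:
  assumes "finite F" and "\<And>x. x \<in> F \<Longrightarrow> A x \<in> tower_ideal T"
  shows "(\<Union>x\<in>F. A x) \<in> tower_ideal T"
  using assms by (induction F) (auto intro: tower_ideal_Un finite_in_tower_ideal)

text \<open>
  A single member of the tower suffices, because of two of them the later one almost contains
  the other.
\<close>

lemma tower_ideal_iff:
  assumes "tower T"
  shows "A \<in> tower_ideal T \<longleftrightarrow> (\<exists>\<alpha> n. A \<subseteq> T \<alpha> \<union> {..<n})"
proof
  let ?I = "{A. \<exists>\<alpha>. finite (A - T \<alpha>)}"
  have "A \<union> B \<in> ?I" if "A \<in> ?I" "B \<in> ?I" for A B
  proof -
    from that obtain \<alpha> \<beta> where *: "finite (A - T \<alpha>)" "finite (B - T \<beta>)" by auto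
    have **: "finite (T \<alpha> - T (max \<alpha> \<beta>))" "finite (T \<beta> - T (max \<alpha> \<beta>))"
      using assms by (simp_all add: tower_def)
    have "finite ((A - T \<alpha>) \<union> (B - T \<beta>) \<union> (T \<alpha> - T (max \<alpha> \<beta>)) \<union> (T \<beta> - T (max \<alpha> \<beta>)))"
      using * ** by blast
    then have "finite (A \<union> B - T (max \<alpha> \<beta>))"
      by (rule finite_subset[rotated]) auto
    then show ?thesis by blast
  qed
  moreover have "B \<in> ?I" if "A \<in> ?I" "B \<subseteq> A" for A B
    using that by (auto intro: finite_subset[of "B - _" "A - _"])
  ultimately have "set_ideal ?I"
    unfolding set_ideal_def by auto
  moreover have "T \<alpha> \<in> ?I" for \<alpha>
    using assms by (auto simp: tower_def)
  then have "range T \<union> Collect finite \<subseteq> ?I" by auto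
  ultimately have "tower_ideal T \<subseteq> ?I"
    unfolding tower_ideal_def by (rule hull_minimal[rotated])
  moreover assume "A \<in> tower_ideal T"
  ultimately obtain \<alpha> where "finite (A - T \<alpha>)" by blast
  then obtain n where "A - T \<alpha> \<subseteq> {..<n}"
    by (meson finite_nat_iff_bounded)
  then show "\<exists>\<alpha> n. A \<subseteq> T \<alpha> \<union> {..<n}" by blast
next
  assume "\<exists>\<alpha> n. A \<subseteq> T \<alpha> \<union> {..<n}"
  then obtain \<alpha> n where "A \<subseteq> T \<alpha> \<union> {..<n}" by blast
  moreover have "T \<alpha> \<union> {..<n} \<in> tower_ideal T"
    by (intro tower_ideal_Un tower_in_tower_ideal finite_in_tower_ideal) simp
  ultimately show "A \<in> tower_ideal T"
    using set_ideal_tower_ideal[of T] unfolding set_ideal_def by blast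
qed

section \<open>Tukey maps\<close>

text \<open>
  The contrapositive form of being Tukey, with bounds named, is the one that can be checked by
  computing bounds.
\<close>

lemma tukey_leI:
  assumes "\<And>x. x \<in> D \<Longrightarrow> g x \<in> E"
    and "\<And>S b. S \<subseteq> D \<Longrightarrow> b \<in> E \<Longrightarrow> (\<And>x. x \<in> S \<Longrightarrow> g x \<le> b) \<Longrightarrow> bounded_in D S"
  shows "tukey_le D E"
  unfolding tukey_le_def tukey_map_def
proof (intro exI conjI allI impI)
  show "g \<in> D \<rightarrow> E" using assms(1) by blast
  show "\<not> bounded_in E (g ` S)" if "S \<subseteq> D" "\<not> bounded_in D S" for S
    using assms(2)[OF \<open>S \<subseteq> D\<close>] that(2) unfolding bounded_in_def[of E] by blast
qed

text \<open>
  Cover \<open>A\<close> by \<open>T \<alpha> \<union> {..<n}\<close> and record \<open>(\<alpha>, n)\<close> as the finite set consisting of \<open>\<alpha>\<close> and the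
  first \<open>n\<close> terms of a fixed injective sequence. A finite set that contains this record has at
  least \<open>n\<close> elements, so it bounds both \<open>\<alpha>\<close> and \<open>n\<close>.
\<close>

lemma tower_ideal_tukey_le_Fpow:
  assumes "tower T"
  shows "tukey_le (tower_ideal T) (Fpow (UNIV :: omega1 set))"
proof -
  have "infinite (UNIV :: omega1 set)"
    using uncountable_omega1 countable_finite by blast
  then obtain s :: "nat \<Rightarrow> omega1" where s: "inj s"
    using infinite_countable_subset by blast
  have "\<forall>A\<in>tower_ideal T. \<exists>\<alpha> n. A \<subseteq> T \<alpha> \<union> {..<n}"
    using tower_ideal_iff[OF assms] by blast
  then obtain a n where cover: "\<And>A. A \<in> tower_ideal T \<Longrightarrow> A \<subseteq> T (a A) \<union> {..<n A}"
    unfolding bchoice_iff by blast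
  show ?thesis
  proof (rule tukey_leI[where g = "\<lambda>A. insert (a A) (s ` {..<n A})"])
    show "insert (a A) (s ` {..<n A}) \<in> Fpow UNIV" for A
      by (simp add: Fpow_def)
    fix S :: "nat set set" and F :: "omega1 set"
    assume S: "S \<subseteq> tower_ideal T" and "F \<in> Fpow UNIV"
      and le: "\<And>A. A \<in> S \<Longrightarrow> insert (a A) (s ` {..<n A}) \<subseteq> F"
    then have F: "finite F" by (simp add: Fpow_def)
    let ?B = "(\<Union>\<alpha>\<in>F. T \<alpha>) \<union> {..<card F}"
    have "?B \<in> tower_ideal T"
      by (intro tower_ideal_Un tower_ideal_UN F tower_in_tower_ideal finite_in_tower_ideal) simp
    moreover have "A \<subseteq> ?B" if "A \<in> S" for A
    proof -
      have "card (s ` {..<n A}) \<le> card F"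
        using le[OF that] F by (intro card_mono) auto
      moreover have "card (s ` {..<n A}) = n A"
        using s by (simp add: card_image inj_on_subset)
      ultimately have "n A \<le> card F" by simp
      moreover have "a A \<in> F" using le[OF that] by simp
      ultimately have "T (a A) \<union> {..<n A} \<subseteq> ?B" by (intro Un_mono) auto
      moreover have "A \<subseteq> T (a A) \<union> {..<n A}" using cover S that by blast
      ultimately show ?thesis by (rule subset_trans[rotated])
    qed
    ultimately show "bounded_in (tower_ideal T) S"
      unfolding bounded_in_def by (intro bexI[of _ ?B] ballI)
  qed
qed

text \<open>
  A bound for a family of values may be enlarged to \<open>T (e \<alpha>) \<union> {..<n}\<close>, as \<open>e\<close> is cofinal. The
  indices of the family then lie in the finite set that condition (H) provides for \<open>\<alpha>\<close> and
  \<open>n\<close>, together with \<open>\<alpha>\<close> itself; no later index can occur, as \<open>T\<close> is a tower.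
\<close>

lemma condition_H_subtower_imp_Fpow_tukey_le:
  assumes T: "tower T" and e: "strict_mono e" and H: "condition_H (T \<circ> e)"
  shows "tukey_le (Fpow (UNIV :: omega1 set)) (tower_ideal T)"
proof (rule tukey_leI[where g = "\<lambda>F. \<Union>\<xi>\<in>F. T (e \<xi>)"])
  show "(\<Union>\<xi>\<in>F. T (e \<xi>)) \<in> tower_ideal T" if "F \<in> Fpow UNIV" for F
    using that by (auto simp: Fpow_def intro!: tower_ideal_UN tower_in_tower_ideal)
  fix S :: "omega1 set set" and B
  assume "B \<in> tower_ideal T" and le: "\<And>F. F \<in> S \<Longrightarrow> (\<Union>\<xi>\<in>F. T (e \<xi>)) \<subseteq> B"
  then obtain \<alpha> k where B: "B \<subseteq> T \<alpha> \<union> {..<k}"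
    using tower_ideal_iff[OF T] by blast
  have "finite (T \<alpha> - T (e \<alpha>))"
    using T strict_mono_omega1_increasing[OF e] by (simp add: tower_def)
  then have "finite (T \<alpha> - T (e \<alpha>) \<union> {..<k})" by simp
  then obtain n where "T \<alpha> - T (e \<alpha>) \<union> {..<k} \<subseteq> {..<n}"
    by (meson finite_nat_iff_bounded)
  then have B: "B \<subseteq> T (e \<alpha>) \<union> {..<n}"
    using B by blast
  let ?U = "insert \<alpha> {\<xi>. \<xi> < \<alpha> \<and> (T \<circ> e) \<xi> - (T \<circ> e) \<alpha> \<subseteq> {..<n}}"
  have "finite ?U"
    using H unfolding condition_H_def by blast
  moreover have "F \<subseteq> ?U" if "F \<in> S" for F
  proof
    fix \<xi> assume "\<xi> \<in> F"
    then have *: "T (e \<xi>) - T (e \<alpha>) \<subseteq> {..<n}"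
      using le[OF that] B by blast
    then have "finite (T (e \<xi>) - T (e \<alpha>))"
      using finite_subset by blast
    then have "\<xi> \<le> \<alpha>"
      using T e by (simp add: tower_def strict_mono_less_eq)
    then show "\<xi> \<in> ?U" using * by auto
  qed
  ultimately show "bounded_in (Fpow UNIV) S"
    unfolding bounded_in_def Fpow_def by blast
qed

section \<open>Recovering a subtower from a Tukey map\<close>

lemma uncountable_constant_nat:
  fixes m :: "'a \<Rightarrow> nat"
  assumes "uncountable (UNIV :: 'a set)"
  obtains k where "uncountable {x. m x = k}"
proof -
  have "(UNIV :: 'a set) = (\<Union>k. {x. m x = k})" by auto
  then show thesis
    using assms that by (metis countableI_type countable_UN)
qed

text \<open>
  An infinite set of singletons is unbounded among the finite sets, so a Tukey map from there
  can send only finitely many singletons below any one member of the target.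
\<close>

lemma tukey_map_Fpow_finite_below:
  assumes g: "tukey_map (Fpow UNIV) E g" and B: "B \<in> E"
  shows "finite {\<xi>. g {\<xi>} \<le> B}"
proof -
  let ?S = "(\<lambda>\<xi>. {\<xi>}) ` {\<xi>. g {\<xi>} \<le> B}"
  have "bounded_in E (g ` ?S)"
    using B unfolding bounded_in_def by auto
  moreover have "?S \<subseteq> Fpow UNIV" by (auto simp: Fpow_def)
  ultimately have "bounded_in (Fpow UNIV) ?S"
    using g unfolding tukey_map_def by blast
  then obtain F where "finite F" "\<forall>x\<in>?S. x \<subseteq> F"
    unfolding bounded_in_def Fpow_def by blast
  then show ?thesis
    by (auto intro: finite_subset[of _ F])
qed

text \<open>
  The finite error in covering \<open>g {\<xi>}\<close> by a member of the tower must be made uniform before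
  \<open>g {\<xi>}\<close> can be exchanged for that member; this is where uncountability of the index set is
  used.
\<close>

lemma uncountable_subfamily_finite_below:
  assumes T: "tower T" and le: "tukey_le (Fpow (UNIV :: omega1 set)) (tower_ideal T)"
  obtains X :: "omega1 set" where "uncountable X"
    and "\<And>B. B \<in> tower_ideal T \<Longrightarrow> finite {\<beta> \<in> X. T \<beta> \<subseteq> B}"
proof -
  obtain g where g: "tukey_map (Fpow (UNIV :: omega1 set)) (tower_ideal T) g"
    using le unfolding tukey_le_def by blast
  have "g {\<xi>} \<in> tower_ideal T" for \<xi>
    using g by (auto simp: tukey_map_def Fpow_def)
  then have "\<forall>\<xi>. \<exists>\<alpha> n. g {\<xi>} \<subseteq> T \<alpha> \<union> {..<n}"
    using tower_ideal_iff[OF T] by blast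
  then obtain h m where cover: "\<And>\<xi>. g {\<xi>} \<subseteq> T (h \<xi>) \<union> {..<m \<xi>}"
    unfolding choice_iff by blast
  obtain k where k: "uncountable {\<xi>. m \<xi> = k}"
    by (rule uncountable_constant_nat[OF uncountable_omega1])
  let ?A = "{\<xi>. m \<xi> = k}"
  have fin: "finite {\<xi> \<in> ?A. T (h \<xi>) \<subseteq> B}" if "B \<in> tower_ideal T" for B
  proof (rule finite_subset)
    show "{\<xi> \<in> ?A. T (h \<xi>) \<subseteq> B} \<subseteq> {\<xi>. g {\<xi>} \<subseteq> B \<union> {..<k}}"
      using cover by blast
    show "finite {\<xi>. g {\<xi>} \<subseteq> B \<union> {..<k}}"
      by (intro tukey_map_Fpow_finite_below[OF g] tower_ideal_Un that finite_in_tower_ideal) simp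
  qed
  show thesis
  proof (rule that)
    show "uncountable (h ` ?A)"
    proof
      assume "countable (h ` ?A)"
      moreover have "countable {\<xi> \<in> ?A. T (h \<xi>) \<subseteq> T \<beta>}" for \<beta>
        by (intro countable_finite fin tower_in_tower_ideal)
      ultimately have "countable (\<Union>\<beta>\<in>h ` ?A. {\<xi> \<in> ?A. T (h \<xi>) \<subseteq> T \<beta>})"
        by (rule countable_UN)
      then have "countable ?A"
        by (rule countable_subset[rotated]) auto
      then show False using k by blast
    qed
    show "finite {\<beta> \<in> h ` ?A. T \<beta> \<subseteq> B}" if "B \<in> tower_ideal T" for B
      by (rule finite_subset[OF _ finite_imageI[OF fin[OF that], of h]]) auto
  qed
qed

lemma Fpow_tukey_le_imp_Hausdorff_tower:
  assumes T: "tower T" and le: "tukey_le (Fpow (UNIV :: omega1 set)) (tower_ideal T)"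
  shows "Hausdorff_tower T"
proof -
  obtain X :: "omega1 set" where "uncountable X"
    and fin: "\<And>B. B \<in> tower_ideal T \<Longrightarrow> finite {\<beta> \<in> X. T \<beta> \<subseteq> B}"
    using uncountable_subfamily_finite_below[OF T le] by blast
  obtain e :: "omega1 \<Rightarrow> omega1" where e: "strict_mono e" and X: "range e \<subseteq> X"
    using uncountable_omega1_strict_mono[OF \<open>uncountable X\<close>] by blast
  have inj: "inj e" using e by (rule strict_mono_imp_inj_on)
  have "uncountable (range e)"
    using uncountable_omega1 inj by (simp add: countable_image_inj_eq)
  moreover have "finite {\<xi>. \<xi> < \<alpha> \<and> (T \<circ> e) \<xi> - (T \<circ> e) \<alpha> \<subseteq> {..<n}}" for \<alpha> n
  proof (rule finite_imageD)
    show "inj_on e {\<xi>. \<xi> < \<alpha> \<and> (T \<circ> e) \<xi> - (T \<circ> e) \<alpha> \<subseteq> {..<n}}"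
      using inj by (rule inj_on_subset) simp
    have "finite {\<beta> \<in> X. T \<beta> \<subseteq> T (e \<alpha>) \<union> {..<n}}"
      by (intro fin tower_ideal_Un tower_in_tower_ideal finite_in_tower_ideal) simp
    then show "finite (e ` {\<xi>. \<xi> < \<alpha> \<and> (T \<circ> e) \<xi> - (T \<circ> e) \<alpha> \<subseteq> {..<n}})"
      by (rule finite_subset[rotated]) (use X in auto)
  qed
  ultimately show ?thesis
    using e unfolding Hausdorff_tower_def condition_H_def by blast
qed

theorem theorem54:
  fixes T :: "omega1 \<Rightarrow> nat set"
  assumes "tower T"
  shows "Hausdorff_tower T \<longleftrightarrow> tukey_equivalent (tower_ideal T) (Fpow (UNIV :: omega1 set))"
proof
  assume "Hausdorff_tower T"
  then obtain e :: "omega1 \<Rightarrow> omega1" where "strict_mono e" "condition_H (T \<circ> e)"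
    unfolding Hausdorff_tower_def by blast
  then show "tukey_equivalent (tower_ideal T) (Fpow (UNIV :: omega1 set))"
    unfolding tukey_equivalent_def
    using condition_H_subtower_imp_Fpow_tukey_le tower_ideal_tukey_le_Fpow assms by blast
next
  assume "tukey_equivalent (tower_ideal T) (Fpow (UNIV :: omega1 set))"
  then show "Hausdorff_tower T"
    using Fpow_tukey_le_imp_Hausdorff_tower assms unfolding tukey_equivalent_def by blast
qed

end
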